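(* Let $d\in\mathbb{N}$, let $\Omega\subset\mathbb{C}^d$ be a nonempty open set, and let $\mathcal{X}\subset\operatorname{Hol}(\Omega)$ be a Hausdorff topological vector space satisfying properties P1, P2, P3 (see context). Then $\Omega_{max}\subseteq\Omega_{env}$.
   Context: All vector spaces are over $\mathbb{C}$; topological vector spaces are not assumed locally convex. $\operatorname{Hol}(\Omega)$ is the space of holomorphic functions on $\Omega$. $\mathcal{P}_d$ is the set of polynomials in $d$ complex variables, viewed (by restriction) as functions on $\Omega$. The properties are: P1: $\mathcal{P}_d\subset\mathcal{X}$ and $\mathcal{P}_d$ is dense in $\mathcal{X}$. P2: for each $w\in\Omega$ the evaluation functional $\Lambda_w(F)=F(w)$, $F\in\mathcal{X}$, is continuous. P3: for each $1\le j\le d$ the shift operator $S_jF(z)=z_jF(z)$ maps $\mathcal{X}$ to $\mathcal{X}$ and is continuous. $\mathcal{X}^*$ is the space of continuous linear functionals on $\mathcal{X}$. A function $F\in\mathcal{X}$ is cyclic if $S[F]:=\overline{\{PF:P\in\mathcal{P}_d\}}$ (closure in $\mathcal{X}$) equals $\mathcal{X}$. Maximal domain: $\Omega_{max}$ is the set of all $w\in\mathbb{C}^d$ such that the functional $P\mapsto P(w)$ on $\mathcal{P}_d$ extends to an element of $\mathcal{X}^*$. Enveloping domain of cyclic polynomials: $\Omega_{env}$ is the set of all $w\in\mathbb{C}^d$ such that $P(w)\neq0$ for every polynomial $P\in\mathcal{P}_d$ that is cyclic in $\mathcal{X}$. *)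

theory Defs
  imports "HOL-Analysis.Analysis"
begin

text \<open>
  Functions on \<open>\<Omega>\<close> are represented by the elements of \<open>extensional \<Omega>\<close>, so that equality of
  representatives is equality on \<open>\<Omega>\<close>. A topological vector space of such functions is given by its
  topology \<open>T\<close>; its underlying set is \<open>topspace T\<close>.
\<close>

definition fun_add ::
    "(complex^'n) set \<Rightarrow> (complex^'n \<Rightarrow> complex) \<Rightarrow> (complex^'n \<Rightarrow> complex) \<Rightarrow> complex^'n \<Rightarrow> complex"
  where "fun_add \<Omega> F G = (\<lambda>z\<in>\<Omega>. F z + G z)"

definition fun_scale ::
    "(complex^'n) set \<Rightarrow> complex \<Rightarrow> (complex^'n \<Rightarrow> complex) \<Rightarrow> complex^'n \<Rightarrow> complex"
  where "fun_scale \<Omega> c F = (\<lambda>z\<in>\<Omega>. c * F z)"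

definition fun_mult ::
    "(complex^'n) set \<Rightarrow> (complex^'n \<Rightarrow> complex) \<Rightarrow> (complex^'n \<Rightarrow> complex) \<Rightarrow> complex^'n \<Rightarrow> complex"
  where "fun_mult \<Omega> F G = (\<lambda>z\<in>\<Omega>. F z * G z)"

text \<open>
  Holomorphy in several variables: Frechet differentiability with a complex-linear derivative
  (\<open>has_derivative\<close> by itself only provides a real-linear one).
\<close>

definition Hol :: "(complex^'n) set \<Rightarrow> (complex^'n \<Rightarrow> complex) set"
  where "Hol \<Omega> = {F \<in> extensional \<Omega>. \<forall>z\<in>\<Omega>. \<exists>D.
    (F has_derivative D) (at z within \<Omega>) \<and> (\<forall>c v. D (c *s v) = c * D v)}"

definition polys :: "(complex^'n \<Rightarrow> complex) set"
  where "polys = {P. \<exists>M (c :: ('n \<Rightarrow> nat) \<Rightarrow> complex). finite M \<and>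
    P = (\<lambda>z. \<Sum>m\<in>M. c m * (\<Prod>i\<in>UNIV. (z $ i) ^ m i))}"

definition fun_tvs :: "(complex^'n) set \<Rightarrow> (complex^'n \<Rightarrow> complex) topology \<Rightarrow> bool"
  where "fun_tvs \<Omega> T \<longleftrightarrow>
    topspace T \<subseteq> extensional \<Omega> \<and>
    (\<lambda>z\<in>\<Omega>. 0) \<in> topspace T \<and>
    (\<forall>F\<in>topspace T. \<forall>G\<in>topspace T. fun_add \<Omega> F G \<in> topspace T) \<and>
    (\<forall>c. \<forall>F\<in>topspace T. fun_scale \<Omega> c F \<in> topspace T) \<and>
    continuous_map (prod_topology T T) T (\<lambda>(F, G). fun_add \<Omega> F G) \<and>
    continuous_map (prod_topology euclidean T) T (\<lambda>(c, F). fun_scale \<Omega> c F)"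

definition P1 :: "(complex^'n) set \<Rightarrow> (complex^'n \<Rightarrow> complex) topology \<Rightarrow> bool"
  where "P1 \<Omega> T \<longleftrightarrow>
    (\<lambda>P. restrict P \<Omega>) ` polys \<subseteq> topspace T \<and>
    T closure_of ((\<lambda>P. restrict P \<Omega>) ` polys) = topspace T"

definition P2 :: "(complex^'n) set \<Rightarrow> (complex^'n \<Rightarrow> complex) topology \<Rightarrow> bool"
  where "P2 \<Omega> T \<longleftrightarrow> (\<forall>w\<in>\<Omega>. continuous_map T euclidean (\<lambda>F. F w))"

definition shift ::
    "(complex^'n) set \<Rightarrow> 'n \<Rightarrow> (complex^'n \<Rightarrow> complex) \<Rightarrow> complex^'n \<Rightarrow> complex"
  where "shift \<Omega> j F = (\<lambda>z\<in>\<Omega>. z $ j * F z)"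

definition P3 :: "(complex^'n) set \<Rightarrow> (complex^'n \<Rightarrow> complex) topology \<Rightarrow> bool"
  where "P3 \<Omega> T \<longleftrightarrow>
    (\<forall>j. shift \<Omega> j ` topspace T \<subseteq> topspace T \<and> continuous_map T T (shift \<Omega> j))"

text \<open>Only the values of a functional on \<open>topspace T\<close> are relevant.\<close>

definition dual ::
    "(complex^'n) set \<Rightarrow> (complex^'n \<Rightarrow> complex) topology \<Rightarrow> ((complex^'n \<Rightarrow> complex) \<Rightarrow> complex) set"
  where "dual \<Omega> T = {L. continuous_map T euclidean L \<and>
    (\<forall>F\<in>topspace T. \<forall>G\<in>topspace T. L (fun_add \<Omega> F G) = L F + L G) \<and>
    (\<forall>c. \<forall>F\<in>topspace T. L (fun_scale \<Omega> c F) = c * L F)}"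

definition cyclic :: "(complex^'n) set \<Rightarrow> (complex^'n \<Rightarrow> complex) topology \<Rightarrow> (complex^'n \<Rightarrow> complex) \<Rightarrow> bool"
  where "cyclic \<Omega> T F \<longleftrightarrow> F \<in> topspace T \<and>
    T closure_of {fun_mult \<Omega> P F | P. P \<in> polys} = topspace T"

definition Omega_max :: "(complex^'n) set \<Rightarrow> (complex^'n \<Rightarrow> complex) topology \<Rightarrow> (complex^'n) set"
  where "Omega_max \<Omega> T = {w. \<exists>L\<in>dual \<Omega> T. \<forall>P\<in>polys. L (restrict P \<Omega>) = P w}"

definition Omega_env :: "(complex^'n) set \<Rightarrow> (complex^'n \<Rightarrow> complex) topology \<Rightarrow> (complex^'n) set"
  where "Omega_env \<Omega> T = {w. \<forall>P\<in>polys. cyclic \<Omega> T (restrict P \<Omega>) \<longrightarrow> P w \<noteq> 0}"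

end

theory Submission imports Defs begin

text \<open>
  If the extension \<open>L\<close> of evaluation at \<open>w\<close> is continuous and \<open>P w = 0\<close>, then \<open>L\<close> vanishes on every
  polynomial multiple of \<open>P\<close>, hence on their closure. For cyclic \<open>P\<close> this closure contains the
  constant \<open>1\<close>, on which \<open>L\<close> takes the value \<open>1\<close>.
\<close>

lemma monomial_in_polys:
  "(\<lambda>z. a * (\<Prod>i\<in>UNIV. (z $ i) ^ m i)) \<in> polys"
  unfolding polys_def by (rule CollectI, rule exI[of _ "{m}"], rule exI[of _ "\<lambda>_. a"]) simp

lemma one_in_polys: "(\<lambda>z. 1) \<in> polys"
  using monomial_in_polys[of 1 "\<lambda>_. 0"] by simp

lemma polys_add:
  assumes "P \<in> polys" "Q \<in> polys"
  shows "(\<lambda>z. P z + Q z) \<in> polys"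
proof -
  obtain M a where M: "finite M" "P = (\<lambda>z. \<Sum>m\<in>M. a m * (\<Prod>i\<in>UNIV. (z $ i) ^ m i))"
    using assms(1) unfolding polys_def by blast
  obtain N b where N: "finite N" "Q = (\<lambda>z. \<Sum>m\<in>N. b m * (\<Prod>i\<in>UNIV. (z $ i) ^ m i))"
    using assms(2) unfolding polys_def by blast
  \<comment> \<open>The exponent sets of \<open>P\<close> and \<open>Q\<close> may differ.
    Coefficient 0 at the missing exponents lets both sums run over \<open>M \<union> N\<close>,
    where they add termwise.\<close>
  define c where "c m = (if m \<in> M then a m else 0) + (if m \<in> N then b m else 0)" for m
  have extend: "(\<Sum>m\<in>A. f m * g m) = (\<Sum>m\<in>M \<union> N. (if m \<in> A then f m else 0) * g m)"
    if "A \<subseteq> M \<union> N" for A and f g :: "('a \<Rightarrow> nat) \<Rightarrow> complex"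
    using that M(1) N(1) by (intro sum.mono_neutral_cong_left) auto
  have "(\<lambda>z. P z + Q z) = (\<lambda>z. \<Sum>m\<in>M \<union> N. c m * (\<Prod>i\<in>UNIV. (z $ i) ^ m i))"
    unfolding M(2) N(2) c_def
    by (simp only: extend[of M, OF Un_upper1] extend[of N, OF Un_upper2] distrib_right sum.distrib)
  then show ?thesis
    unfolding polys_def using M(1) N(1) by blast
qed

lemma polys_sum:
  assumes "\<And>k. k \<in> K \<Longrightarrow> P k \<in> polys"
  shows "(\<lambda>z. \<Sum>k\<in>K. P k z) \<in> polys"
proof -
  \<comment> \<open>Covers two cases of the induction: empty \<open>K\<close>, and infinite
    \<open>K\<close>, where the sum is 0 by convention.\<close>
  have "(\<lambda>z. 0) \<in> polys"
    using monomial_in_polys[of 0] by simp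
  then show ?thesis
    using assms by (induction K rule: infinite_finite_induct) (auto intro: polys_add)
qed

text \<open>Exponents of monomials add, so the product expands into a double sum of monomials.
  Several pairs may share an exponent; nesting \<open>polys_sum\<close> avoids collecting their
  coefficients.\<close>

lemma polys_mult:
  assumes "P \<in> polys" "Q \<in> polys"
  shows "(\<lambda>z. P z * Q z) \<in> polys"
proof -
  obtain M a where M: "P = (\<lambda>z. \<Sum>m\<in>M. a m * (\<Prod>i\<in>UNIV. (z $ i) ^ m i))"
    using assms(1) unfolding polys_def by blast
  obtain N b where N: "Q = (\<lambda>z. \<Sum>n\<in>N. b n * (\<Prod>i\<in>UNIV. (z $ i) ^ n i))"
    using assms(2) unfolding polys_def by blast
  have "(\<lambda>z. P z * Q z) =
      (\<lambda>z. \<Sum>m\<in>M. \<Sum>n\<in>N. (a m * b n) * (\<Prod>i\<in>UNIV. (z $ i) ^ (m i + n i)))"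
    unfolding M N by (simp only: sum_product power_add prod.distrib mult_ac)
  then show ?thesis
    by (simp only:) (intro polys_sum monomial_in_polys)
qed

theorem proposition2p7:
  fixes \<Omega> :: "(complex^'n) set" and T :: "(complex^'n \<Rightarrow> complex) topology"
  assumes "open \<Omega>" and "\<Omega> \<noteq> {}"
    and "topspace T \<subseteq> Hol \<Omega>" and "fun_tvs \<Omega> T" and "Hausdorff_space T"
    and "P1 \<Omega> T" and "P2 \<Omega> T" and "P3 \<Omega> T"
  shows "Omega_max \<Omega> T \<subseteq> Omega_env \<Omega> T"
proof -
  have in_T: "restrict P \<Omega> \<in> topspace T" if "P \<in> polys" for P
    using \<open>P1 \<Omega> T\<close> that unfolding P1_def by blast
  have "P w \<noteq> 0"
    if L: "L \<in> dual \<Omega> T" "\<forall>P\<in>polys. L (restrict P \<Omega>) = P w"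
      and P: "P \<in> polys" "cyclic \<Omega> T (restrict P \<Omega>)" for w L P
  proof
    assume "P w = 0"
    \<comment> \<open>The kernel of \<open>L\<close>, phrased as the preimage of the closed set
      \<open>{0}\<close> to match \<open>closedin_continuous_map_preimage\<close>.\<close>
    let ?K = "{F \<in> topspace T. L F \<in> {0}}"
    have "continuous_map T euclidean L"
      using L(1) unfolding dual_def by blast
    then have closed: "closedin T ?K"
      by (rule closedin_continuous_map_preimage) simp
    have "{fun_mult \<Omega> Q (restrict P \<Omega>) | Q. Q \<in> polys} \<subseteq> ?K"
    proof clarify
      fix Q :: "complex^'n \<Rightarrow> complex"
      assume "Q \<in> polys"
      then have QP: "(\<lambda>z. Q z * P z) \<in> polys"
        using P(1) by (rule polys_mult)
      \<comment> \<open>The point \<open>w\<close> may lie outside \<open>\<Omega>\<close>, so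
        \<open>L\<close> is known only on restrictions of polynomials. Recognising the product as
        one gives it the value \<open>Q w * P w = 0\<close>.\<close>
      have "fun_mult \<Omega> Q (restrict P \<Omega>) = restrict (\<lambda>z. Q z * P z) \<Omega>"
        by (auto simp: fun_mult_def)
      then show "fun_mult \<Omega> Q (restrict P \<Omega>) \<in> topspace T \<and> L (fun_mult \<Omega> Q (restrict P \<Omega>)) \<in> {0}"
        using in_T[OF QP] L(2) QP \<open>P w = 0\<close> by simp
    qed
    then have "T closure_of {fun_mult \<Omega> Q (restrict P \<Omega>) | Q. Q \<in> polys} \<subseteq> ?K"
      using closed by (rule closure_of_minimal)
    then have "topspace T \<subseteq> ?K"
      using P(2) by (simp only: cyclic_def)
    then have "L (restrict (\<lambda>z. 1) \<Omega>) = 0"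
      using in_T[OF one_in_polys] by blast
    then show False
      using bspec[OF L(2) one_in_polys] by simp
  qed
  then show ?thesis
    unfolding Omega_max_def Omega_env_def by blast
qed

end
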